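(* Let $q\ge 2$ be an integer and let $f$ be a $q$-regular sequence with a zero-insensitive minimal linear representation $(\mathbf{u},(M_i)_{0\le i<q},\mathbf{v})$, so that $f(n)=\mathbf{u}^t M_{n_0}M_{n_1}\cdots M_{n_L}\mathbf{v}$ where $n_L\cdots n_0$ is the $q$-ary expansion of $n$. Let $r$ be a nonnegative integer. Then the following two assertions are equivalent: (i) $f$ is $q$-quasimultiplicative with parameter $r$, i.e. $f(q^{k+r}a+b)=f(a)f(b)$ for all nonnegative integers $a,b,k$ with $0\le b<q^k$; (ii) $M_0^r=\mathbf{v}\mathbf{u}^t$.
   Context: A function $f$ on the nonnegative integers is $q$-regular if there exist a vector $\mathbf{u}$, a vector-valued function $\mathbf{f}$ and square matrices $M_0,\dots,M_{q-1}$ such that $f=\mathbf{u}^t\mathbf{f}$ and $\mathbf{f}(qn+i)=M_i\mathbf{f}(n)$ for all $0\le i<q$ and all $n$ with $qn+i>0$; one sets $\mathbf{v}=\mathbf{f}(0)$. Equivalently $f(n)=\mathbf{u}^t M_{n_0}M_{n_1}\cdots M_{n_L}\mathbf{v}$, where $n_L\cdots n_0$ is the $q$-ary expansion of $n$ ($n_0$ least significant). The triple $(\mathbf{u},(M_i)_{0\le i<q},\mathbf{v})$ is called a linear representation of $f$. It is zero-insensitive if $M_0\mathbf{v}=\mathbf{v}$, and minimal if the dimension of the matrices $M_i$ is minimal among all linear representations of $f$. *)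

theory Defs
  imports "Jordan_Normal_Form.Matrix"
begin

text \<open>The vector-valued function \<open>F\<close> is the one written in boldface; \<open>v\<close> is its value at 0.
  Only the matrices \<open>M i\<close> with \<open>i < q\<close> are relevant. The dimension \<open>d\<close> may be 0; this is the
  minimal dimension for the zero function.\<close>

definition linear_representation ::
  "nat \<Rightarrow> nat \<Rightarrow> 'a::field vec \<Rightarrow> (nat \<Rightarrow> 'a mat) \<Rightarrow> 'a vec \<Rightarrow> (nat \<Rightarrow> 'a) \<Rightarrow> bool" where
  "linear_representation q d u M v f \<longleftrightarrow>
     u \<in> carrier_vec d \<and> v \<in> carrier_vec d \<and> (\<forall>i<q. M i \<in> carrier_mat d d) \<and>
     (\<exists>F :: nat \<Rightarrow> 'a vec.
        (\<forall>n. F n \<in> carrier_vec d) \<and>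
        F 0 = v \<and>
        (\<forall>n i. i < q \<and> q * n + i > 0 \<longrightarrow> F (q * n + i) = M i *\<^sub>v F n) \<and>
        (\<forall>n. f n = u \<bullet> F n))"

definition q_regular :: "nat \<Rightarrow> (nat \<Rightarrow> 'a::field) \<Rightarrow> bool" where
  "q_regular q f \<longleftrightarrow> (\<exists>d u M v. linear_representation q d u M v f)"

definition zero_insensitive :: "(nat \<Rightarrow> 'a::field mat) \<Rightarrow> 'a vec \<Rightarrow> bool" where
  "zero_insensitive M v \<longleftrightarrow> M 0 *\<^sub>v v = v"

definition minimal_linear_representation ::
  "nat \<Rightarrow> nat \<Rightarrow> 'a::field vec \<Rightarrow> (nat \<Rightarrow> 'a mat) \<Rightarrow> 'a vec \<Rightarrow> (nat \<Rightarrow> 'a) \<Rightarrow> bool" where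
  "minimal_linear_representation q d u M v f \<longleftrightarrow>
     linear_representation q d u M v f \<and>
     (\<forall>d' u' M' v'. linear_representation q d' u' M' v' f \<longrightarrow> d \<le> d')"

definition quasimultiplicative :: "nat \<Rightarrow> nat \<Rightarrow> (nat \<Rightarrow> 'a::field) \<Rightarrow> bool" where
  "quasimultiplicative q r f \<longleftrightarrow>
     (\<forall>a b k. b < q ^ k \<longrightarrow> f (q ^ (k + r) * a + b) = f a * f b)"

definition outer_product :: "'a::field vec \<Rightarrow> 'a vec \<Rightarrow> 'a mat" where
  "outer_product v u = mat (dim_vec v) (dim_vec u) (\<lambda>(i, j). v $ i * u $ j)"

text \<open>The matrix product form of a linear representation: \<open>ds\<close> lists the digits of the \<open>q\<close>-ary
  expansion from the least significant one upwards, so the expansion of 0 is the empty list.\<close>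

lemma linear_representation_digits:
  assumes "linear_representation q d u M v f"
    and "\<forall>x\<in>set ds. x < q" and "ds \<noteq> [] \<longrightarrow> last ds \<noteq> 0"
  shows "f (foldr (\<lambda>x n. q * n + x) ds 0) = u \<bullet> foldr (\<lambda>x w. M x *\<^sub>v w) ds v"
proof -
  obtain F where F0: "F 0 = v" and f: "\<And>n. f n = u \<bullet> F n"
    and Fr: "\<And>n i. i < q \<Longrightarrow> q * n + i > 0 \<Longrightarrow> F (q * n + i) = M i *\<^sub>v F n"
    using assms(1) unfolding linear_representation_def by blast
  have "F (foldr (\<lambda>x n. q * n + x) ds 0) = foldr (\<lambda>x w. M x *\<^sub>v w) ds v \<and>
        (ds \<noteq> [] \<longrightarrow> foldr (\<lambda>x n. q * n + x) ds 0 > 0)"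
    using assms(2,3)
  proof (induction ds)
    case Nil
    then show ?case by (simp add: F0)
  next
    case (Cons x ds)
    let ?n = "foldr (\<lambda>x n. q * n + x) ds 0"
    have x: "x < q" using Cons.prems by simp
    have IH: "F ?n = foldr (\<lambda>x w. M x *\<^sub>v w) ds v" "ds \<noteq> [] \<longrightarrow> ?n > 0"
      using Cons by (auto split: if_splits)
    have "q * ?n + x > 0"
      using Cons.prems IH(2) x by (cases "ds = []") auto
    then show ?case using Fr[OF x] IH(1) by simp
  qed
  then show ?thesis using f by simp
qed

end

theory Submission
  imports Defs
begin

text \<open>In a zero-insensitive representation \<open>F (q * n + i) = M i *\<^sub>v F n\<close> holds for all \<open>n\<close> and
  \<open>i < q\<close>. Minimality is used twice. No nonzero vector is orthogonal to all \<open>F n\<close>, since otherwise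
  the representation could be restricted to a proper subspace. Moreover, no nonzero vector lies in a
  set that is orthogonal to \<open>u\<close> and invariant under all \<open>M i\<close>, since otherwise one could pass to a
  quotient. If \<open>f\<close> is quasimultiplicative, the vectors \<open>F (q ^ (k + r) * a + b) - f a \<cdot>\<^sub>v F b\<close> form
  such a set, hence vanish; taking \<open>k = b = 0\<close> gives \<open>M 0 ^\<^sub>m r *\<^sub>v F a = (u \<bullet> F a) \<cdot>\<^sub>v v\<close> for all
  \<open>a\<close>, so that each row of \<open>M 0 ^\<^sub>m r - outer_product v u\<close> is orthogonal to all \<open>F a\<close>.\<close>

section \<open>Coordinates on a proper subspace\<close>

text \<open>Gaussian elimination, one coordinate of \<open>I\<close> at a time. The members of
  \<open>U\<close> with \<open>w $ j = 0\<close> are determined by the remaining coordinates; either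
  they are all of \<open>U\<close>, or one further vector \<open>z\<close> with
  \<open>z $ j \<noteq> 0\<close> completes their spanning family. The vectors \<open>p k\<close>
  represent the coefficient functionals.\<close>

lemma subspace_spanned_by_determining_coordinates:
  fixes U :: "'a::field vec set"
  assumes "finite I" and "I \<subseteq> {..<d}" and "U \<subseteq> carrier_vec d"
    and "\<And>w z c. w \<in> U \<Longrightarrow> z \<in> U \<Longrightarrow> w - c \<cdot>\<^sub>v z \<in> U"
    and "\<And>w. w \<in> U \<Longrightarrow> (\<forall>i\<in>I. w $ i = 0) \<Longrightarrow> w = 0\<^sub>v d"
  shows "\<exists>e b p. e \<le> card I \<and> (\<forall>k<e. b k \<in> U \<and> p k \<in> carrier_vec d) \<and>
           (\<forall>w\<in>U. \<forall>i<d. w $ i = (\<Sum>k<e. (p k \<bullet> w) * b k $ i))"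
  using assms
proof (induction I arbitrary: U rule: finite_induct)
  case empty
  have "w $ i = 0" if w: "w \<in> U" and i: "i < d" for w i
  proof -
    have "w = 0\<^sub>v d" by (rule empty.prems(4)[OF w]) simp
    then show ?thesis using i by simp
  qed
  then show ?case
    by (intro exI[of _ "0::nat"]) simp
next
  case (insert j I)
  let ?U' = "{w \<in> U. w $ j = 0}"
  have j: "j < d" using insert.prems by auto
  have "w - c \<cdot>\<^sub>v z \<in> ?U'" if "w \<in> ?U'" "z \<in> ?U'" for w z c
  proof -
    have "w \<in> carrier_vec d" "z \<in> carrier_vec d" using that insert.prems(2) by auto
    moreover have "w - c \<cdot>\<^sub>v z \<in> U" using that by (intro insert.prems(3)) auto
    ultimately show ?thesis using that j by simp
  qed
  then have "\<exists>e b p. e \<le> card I \<and> (\<forall>k<e. b k \<in> ?U' \<and> p k \<in> carrier_vec d) \<and>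
           (\<forall>w\<in>?U'. \<forall>i<d. w $ i = (\<Sum>k<e. (p k \<bullet> w) * b k $ i))"
  proof (intro insert.IH)
    show "I \<subseteq> {..<d}" "?U' \<subseteq> carrier_vec d" using insert.prems(1,2) by auto
    show "w = 0\<^sub>v d" if "w \<in> ?U'" "\<forall>i\<in>I. w $ i = 0" for w
      using that by (intro insert.prems(4)) auto
  qed
  then obtain e b p where e: "e \<le> card I"
    and bp: "\<And>k. k < e \<Longrightarrow> b k \<in> U" "\<And>k. k < e \<Longrightarrow> p k \<in> carrier_vec d"
    and exp: "\<And>w i. w \<in> U \<Longrightarrow> w $ j = 0 \<Longrightarrow> i < d \<Longrightarrow> w $ i = (\<Sum>k<e. (p k \<bullet> w) * b k $ i)"
    by blast
  show ?case
  proof (cases "\<exists>z\<in>U. z $ j \<noteq> 0")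
    case False
    then have "\<forall>w\<in>U. \<forall>i<d. w $ i = (\<Sum>k<e. (p k \<bullet> w) * b k $ i)" using exp by blast
    moreover have "e \<le> card (insert j I)" using e insert.hyps by simp
    ultimately show ?thesis using bp by (intro exI[of _ e] exI[of _ b] exI[of _ p]) simp
  next
    case True
    then obtain z where z: "z \<in> U" "z $ j \<noteq> 0" by auto
    have zc: "z \<in> carrier_vec d" using z insert.prems by auto
    define b' where "b' = b(e := z)"
    \<comment> \<open>Subtracting \<open>w $ j / z $ j\<close> times \<open>z\<close> from
      \<open>w\<close> clears entry \<open>j\<close>, so \<open>exp\<close> applies to the
      difference. Evaluating the old functionals there gives the correction term; the last
      functional is the coefficient of \<open>z\<close>.\<close>
    define p' where "p' = (\<lambda>k. if k < e then p k - (p k \<bullet> z / z $ j) \<cdot>\<^sub>v unit_vec d j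
                               else (1 / z $ j) \<cdot>\<^sub>v unit_vec d j)"
    have "w $ i = (\<Sum>k<Suc e. (p' k \<bullet> w) * b' k $ i)" if w: "w \<in> U" and i: "i < d" for w i
    proof -
      let ?y = "w - (w $ j / z $ j) \<cdot>\<^sub>v z"
      have wc: "w \<in> carrier_vec d" using w insert.prems by auto
      have "?y $ i = (\<Sum>k<e. (p k \<bullet> ?y) * b k $ i)"
        using insert.prems(3)[OF w z(1)] wc zc z(2) i j by (intro exp) auto
      moreover have "p k \<bullet> ?y = p' k \<bullet> w" if k: "k < e" for k
        using bp(2)[OF k] wc zc j k
        by (simp add: p'_def scalar_prod_minus_distrib[of _ d] minus_scalar_prod_distrib[of _ d])
      ultimately have "?y $ i = (\<Sum>k<e. (p' k \<bullet> w) * b k $ i)" by simp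
      then have "w $ i = (\<Sum>k<e. (p' k \<bullet> w) * b k $ i) + (w $ j / z $ j) * z $ i"
        using wc zc i by (simp add: algebra_simps)
      then show ?thesis using wc j by (simp add: b'_def p'_def)
    qed
    moreover have "b' k \<in> U" "p' k \<in> carrier_vec d" if "k < Suc e" for k
      using that bp z by (auto simp: b'_def p'_def less_Suc_eq)
    moreover have "Suc e \<le> card (insert j I)" using e insert.hyps by simp
    ultimately show ?thesis
      by (intro exI[of _ "Suc e"] exI[of _ b'] exI[of _ p'] conjI allI ballI impI)
  qed
qed

text \<open>Where \<open>x $ j\<close> is nonzero, the equation \<open>x \<bullet> w = 0\<close>
  recovers \<open>w $ j\<close> from the other entries, so \<open>d - 1\<close> coordinates
  determine a member of \<open>U\<close>. \<open>P\<close> reads off coefficients and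
  \<open>B\<close> recombines them; the bound \<open>e < d\<close> is what later contradicts
  minimality.\<close>

lemma proper_subspace_factorization:
  fixes U :: "'a::field vec set"
  assumes U: "U \<subseteq> carrier_vec d"
    and cl: "\<And>w z c. w \<in> U \<Longrightarrow> z \<in> U \<Longrightarrow> w - c \<cdot>\<^sub>v z \<in> U"
    and x: "x \<in> carrier_vec d" "x \<noteq> 0\<^sub>v d" "\<And>w. w \<in> U \<Longrightarrow> x \<bullet> w = 0"
  obtains e B P where "e < d" "B \<in> carrier_mat d e" "P \<in> carrier_mat e d"
    "\<And>k. k < e \<Longrightarrow> col B k \<in> U" "\<And>w. w \<in> U \<Longrightarrow> B *\<^sub>v (P *\<^sub>v w) = w"
proof -
  obtain j where j: "j < d" "x $ j \<noteq> 0" using x by (metis carrier_vecD eq_vecI index_zero_vec)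
  have "w = 0\<^sub>v d" if w: "w \<in> U" "\<forall>i\<in>{..<d} - {j}. w $ i = 0" for w
  proof (rule eq_vecI)
    have "(\<Sum>i\<in>{0..<d}. x $ i * w $ i) = x $ j * w $ j"
      using w j by (subst sum.remove[of _ j]) (auto intro!: sum.neutral)
    then have "w $ j = 0" using x(3)[OF w(1)] U w(1) j by (auto simp: scalar_prod_def)
    then show "w $ i = 0\<^sub>v d $ i" if "i < dim_vec (0\<^sub>v d)" for i
      using w(2) that by (cases "i = j") auto
  qed (use U w in auto)
  then have "\<exists>e b p. e \<le> card ({..<d} - {j}) \<and> (\<forall>k<e. b k \<in> U \<and> p k \<in> carrier_vec d) \<and>
           (\<forall>w\<in>U. \<forall>i<d. w $ i = (\<Sum>k<e. (p k \<bullet> w) * b k $ i))"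
    using U cl by (intro subspace_spanned_by_determining_coordinates) auto
  then obtain e b p where "e \<le> card ({..<d} - {j})"
    and bp: "\<And>k. k < e \<Longrightarrow> b k \<in> U" "\<And>k. k < e \<Longrightarrow> p k \<in> carrier_vec d"
    and exp: "\<And>w i. w \<in> U \<Longrightarrow> i < d \<Longrightarrow> w $ i = (\<Sum>k<e. (p k \<bullet> w) * b k $ i)"
    by blast
  then have e: "e < d" using j by simp
  define B where "B = mat d e (\<lambda>(i, k). b k $ i)"
  define P where "P = mat e d (\<lambda>(k, i). p k $ i)"
  have col: "col B k = b k" if "k < e" for k
    using that subsetD[OF U bp(1)[OF that]] by (auto simp: B_def)
  have row: "row P k = p k" if "k < e" for k
    using that bp(2)[OF that] by (auto simp: P_def)
  have "B *\<^sub>v (P *\<^sub>v w) = w" if w: "w \<in> U" for w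
  proof (rule eq_vecI)
    have "w \<in> carrier_vec d" using w U by auto
    then show "dim_vec (B *\<^sub>v (P *\<^sub>v w)) = dim_vec w" by (simp add: B_def)
    fix i assume "i < dim_vec w"
    then have i: "i < d" using \<open>w \<in> carrier_vec d\<close> by simp
    have dP: "dim_row P = e" by (simp add: P_def)
    have "(B *\<^sub>v (P *\<^sub>v w)) $ i = (\<Sum>k\<in>{0..<e}. b k $ i * (P *\<^sub>v w) $ k)"
      using i by (simp add: B_def scalar_prod_def dP)
    also have "\<dots> = (\<Sum>k<e. (p k \<bullet> w) * b k $ i)"
      by (rule sum.cong) (auto simp: dP row)
    finally show "(B *\<^sub>v (P *\<^sub>v w)) $ i = w $ i" using exp[OF w i] by simp
  qed
  with that[of e B P] e bp col show thesis by (simp add: B_def P_def)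
qed

section \<open>Consequences of minimality\<close>

text \<open>Serves to compress a representation: \<open>C\<close> is \<open>P\<close> when
  restricting to a subspace and \<open>B\<^sup>T\<close> when passing to a quotient.\<close>

lemma linear_representation_transform:
  assumes "C \<in> carrier_mat e d" and "u' \<in> carrier_vec e"
    and "\<And>i. i < q \<Longrightarrow> M' i \<in> carrier_mat e e"
    and "\<And>n. F n \<in> carrier_vec d"
    and "\<And>n i. i < q \<Longrightarrow> C *\<^sub>v F (q * n + i) = M' i *\<^sub>v (C *\<^sub>v F n)"
    and "\<And>n. f n = u' \<bullet> (C *\<^sub>v F n)"
  shows "linear_representation q e u' M' (C *\<^sub>v F 0) f"
  using assms unfolding linear_representation_def
  by (intro conjI exI[of _ "\<lambda>n. C *\<^sub>v F n"]) auto

text \<open>Zero-insensitivity is contained in \<open>F_step\<close>, which omits the condition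
  \<open>q * n + i > 0\<close>: for \<open>n = i = 0\<close> it says that \<open>M 0\<close> fixes
  the initial vector \<open>F 0\<close>.\<close>

locale zero_insensitive_minimal_representation =
  fixes q d :: nat and u :: "'a::field vec" and M F f
  assumes u: "u \<in> carrier_vec d"
    and M: "\<And>i. i < q \<Longrightarrow> M i \<in> carrier_mat d d"
    and F: "\<And>n. F n \<in> carrier_vec d"
    and F_step: "\<And>n i. i < q \<Longrightarrow> F (q * n + i) = M i *\<^sub>v F n"
    and f_eq: "\<And>n. f n = u \<bullet> F n"
    and minimal: "\<And>e u' M' v'. linear_representation q e u' M' v' f \<Longrightarrow> d \<le> e"
begin

text \<open>The hyperplane \<open>U\<close> orthogonal to \<open>x\<close> need not be invariant
  under the \<open>M i\<close>. It suffices that it contains every \<open>F n\<close>: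
  \<open>B\<close> restores \<open>F n\<close> from \<open>P *\<^sub>v F n\<close> before
  \<open>M i\<close> is applied.\<close>

lemma orthogonal_to_range_imp_zero:
  assumes x: "x \<in> carrier_vec d" and orth: "\<And>n. x \<bullet> F n = 0"
  shows "x = 0\<^sub>v d"
proof (rule ccontr)
  assume x0: "x \<noteq> 0\<^sub>v d"
  define U where "U = {w \<in> carrier_vec d. x \<bullet> w = 0}"
  have cl: "w - c \<cdot>\<^sub>v z \<in> U" if "w \<in> U" "z \<in> U" for w z c
    using that x by (auto simp: U_def scalar_prod_minus_distrib[of _ d])
  obtain e B P where e: "e < d" and B: "B \<in> carrier_mat d e" and P: "P \<in> carrier_mat e d"
    and BP: "\<And>w. w \<in> U \<Longrightarrow> B *\<^sub>v (P *\<^sub>v w) = w"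
  proof (rule proper_subspace_factorization[of U d x])
    show "U \<subseteq> carrier_vec d" "\<And>w. w \<in> U \<Longrightarrow> x \<bullet> w = 0" by (auto simp: U_def)
  qed (use cl x x0 in auto)
  have BPF: "B *\<^sub>v (P *\<^sub>v F n) = F n" for n using BP F orth by (simp add: U_def)
  have PF: "P *\<^sub>v F n \<in> carrier_vec e" for n using P F by auto
  have "P *\<^sub>v F (q * n + i) = (P * (M i * B)) *\<^sub>v (P *\<^sub>v F n)" if i: "i < q" for n i
  proof -
    have "(P * (M i * B)) *\<^sub>v (P *\<^sub>v F n) = P *\<^sub>v (M i *\<^sub>v (B *\<^sub>v (P *\<^sub>v F n)))"
      using P M[OF i] B PF by (subst assoc_mult_mat_vec) auto
    then show ?thesis using F_step[OF i] BPF by simp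
  qed
  moreover have "f n = (B\<^sup>T *\<^sub>v u) \<bullet> (P *\<^sub>v F n)" for n
    using transpose_vec_mult_scalar[OF B PF u] BPF f_eq by simp
  ultimately have "linear_representation q e (B\<^sup>T *\<^sub>v u) (\<lambda>i. P * (M i * B)) (P *\<^sub>v F 0) f"
    using P M B F u
    by (intro linear_representation_transform[where d = d]) auto
  from minimal[OF this] e show False by simp
qed

text \<open>Dual to the previous argument. The annihilator \<open>U\<close> of \<open>N\<close>
  contains \<open>u\<close> and is proper because of \<open>x\<close>. The new state
  \<open>B\<^sup>T *\<^sub>v F n\<close> lists the values at \<open>F n\<close> of functionals
  spanning \<open>U\<close>, that is, \<open>F n\<close> modulo the vectors killed by
  \<open>U\<close>.\<close>

lemma invariant_set_orthogonal_to_functional_imp_zero: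
  assumes N: "N \<subseteq> carrier_vec d"
    and invariant: "\<And>i y. i < q \<Longrightarrow> y \<in> N \<Longrightarrow> M i *\<^sub>v y \<in> N"
    and orth: "\<And>y. y \<in> N \<Longrightarrow> u \<bullet> y = 0"
    and x: "x \<in> N"
  shows "x = 0\<^sub>v d"
proof (rule ccontr)
  assume x0: "x \<noteq> 0\<^sub>v d"
  define U where "U = {w \<in> carrier_vec d. \<forall>y\<in>N. w \<bullet> y = 0}"
  have cl: "w - c \<cdot>\<^sub>v z \<in> U" if "w \<in> U" "z \<in> U" for w z c
    using that N by (auto simp: U_def minus_scalar_prod_distrib[of _ d] subset_iff)
  have xc: "x \<in> carrier_vec d" using x N by auto
  have xU: "x \<bullet> w = 0" if "w \<in> U" for w
    using that x xc by (auto simp: U_def comm_scalar_prod[of x d])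
  obtain e B P where e: "e < d" and B: "B \<in> carrier_mat d e" and P: "P \<in> carrier_mat e d"
    and col: "\<And>k. k < e \<Longrightarrow> col B k \<in> U" and BP: "\<And>w. w \<in> U \<Longrightarrow> B *\<^sub>v (P *\<^sub>v w) = w"
  proof (rule proper_subspace_factorization[of U d x])
    show "U \<subseteq> carrier_vec d" by (auto simp: U_def)
  qed (use cl xc x0 xU in auto)
  \<comment> \<open>The compressed vector still determines the value of every functional in
    \<open>U\<close>, since \<open>w\<close> is the combination of the columns of \<open>B\<close>
    with coefficients \<open>P *\<^sub>v w\<close>.\<close>
  have functional: "(P *\<^sub>v w) \<bullet> (B\<^sup>T *\<^sub>v y) = w \<bullet> y" if w: "w \<in> U" and y: "y \<in> carrier_vec d" for w y
  proof -
    have wc: "w \<in> carrier_vec d" using w by (simp add: U_def)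
    have Pw: "P *\<^sub>v w \<in> carrier_vec e" using P wc by auto
    have "(P *\<^sub>v w) \<bullet> (B\<^sup>T *\<^sub>v y) = (B\<^sup>T *\<^sub>v y) \<bullet> (P *\<^sub>v w)"
      using Pw B y by (intro comm_scalar_prod[of _ e]) auto
    also have "\<dots> = y \<bullet> w"
      using transpose_vec_mult_scalar[OF B Pw y] BP[OF w] by simp
    finally show ?thesis using comm_scalar_prod[OF y wc] by simp
  qed
  have "B\<^sup>T *\<^sub>v F (q * n + i) = (B\<^sup>T * (M i * P\<^sup>T)) *\<^sub>v (B\<^sup>T *\<^sub>v F n)" if i: "i < q" for n i
  proof -
    have BF: "B\<^sup>T *\<^sub>v F n \<in> carrier_vec e" using B F by auto
    have "(B\<^sup>T * (M i * P\<^sup>T)) *\<^sub>v (B\<^sup>T *\<^sub>v F n) = B\<^sup>T *\<^sub>v (M i *\<^sub>v (P\<^sup>T *\<^sub>v (B\<^sup>T *\<^sub>v F n)))"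
      using P M[OF i] B BF by (subst assoc_mult_mat_vec) auto
    \<comment> \<open>\<open>P\<^sup>T *\<^sub>v (B\<^sup>T *\<^sub>v F n)\<close> may differ from
      \<open>F n\<close>, but functionals in \<open>U\<close> do not distinguish them. Entry
      \<open>k\<close> tests with \<open>col B k\<close> after \<open>M i\<close>, hence with the
      transposed image \<open>?w\<close>, which stays in \<open>U\<close>.\<close>
    also have "\<dots> = B\<^sup>T *\<^sub>v (M i *\<^sub>v F n)"
    proof (rule eq_vecI)
      fix k assume "k < dim_vec (B\<^sup>T *\<^sub>v (M i *\<^sub>v F n))"
      then have k: "k < e" using B by simp
      let ?w = "(M i)\<^sup>T *\<^sub>v col B k"
      let ?z = "P\<^sup>T *\<^sub>v (B\<^sup>T *\<^sub>v F n)"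
      have z: "?z \<in> carrier_vec d" using P BF by auto
      have bc: "col B k \<in> carrier_vec d" using B by auto
      have wc: "?w \<in> carrier_vec d" using M[OF i] bc by auto
      \<comment> \<open>Invariance of \<open>N\<close> under \<open>M i\<close> becomes invariance
        of its annihilator under the transpose.\<close>
      have "?w \<bullet> y = 0" if "y \<in> N" for y
        using transpose_vec_mult_scalar[OF M[OF i] _ bc, of y] that N invariant[OF i that] col[OF k]
        by (auto simp: U_def)
      then have wU: "?w \<in> U" using wc by (simp add: U_def)
      have "col B k \<bullet> (M i *\<^sub>v ?z) = ?w \<bullet> ?z"
        using transpose_vec_mult_scalar[OF M[OF i] z bc] by simp
      also have "\<dots> = ?z \<bullet> ?w" using comm_scalar_prod[OF wc z] .
      also have "\<dots> = (B\<^sup>T *\<^sub>v F n) \<bullet> (P *\<^sub>v ?w)"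
        using transpose_vec_mult_scalar[OF P wc BF] .
      also have "\<dots> = (P *\<^sub>v ?w) \<bullet> (B\<^sup>T *\<^sub>v F n)"
        using P wc BF by (intro comm_scalar_prod[of _ e]) auto
      also have "\<dots> = ?w \<bullet> F n" using functional[OF wU F] .
      also have "\<dots> = col B k \<bullet> (M i *\<^sub>v F n)"
        using transpose_vec_mult_scalar[OF M[OF i] F bc] .
      finally show "(B\<^sup>T *\<^sub>v (M i *\<^sub>v ?z)) $ k = (B\<^sup>T *\<^sub>v (M i *\<^sub>v F n)) $ k"
        using k B by simp
    qed simp
    finally show ?thesis using F_step[OF i] by simp
  qed
  moreover have "f n = (P *\<^sub>v u) \<bullet> (B\<^sup>T *\<^sub>v F n)" for n
    using functional[OF _ F] u orth f_eq by (simp add: U_def)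
  ultimately have
    "linear_representation q e (P *\<^sub>v u) (\<lambda>i. B\<^sup>T * (M i * P\<^sup>T)) (B\<^sup>T *\<^sub>v F 0) f"
    using P M B F u
    by (intro linear_representation_transform[where d = d]) auto
  from minimal[OF this] e show False by simp
qed

end

section \<open>The equivalence\<close>

lemma outer_product_mult_vec:
  assumes "u \<in> carrier_vec n" and "x \<in> carrier_vec n"
  shows "outer_product v u *\<^sub>v x = (u \<bullet> x) \<cdot>\<^sub>v v"
  using assms
  by (intro eq_vecI)
     (auto simp: outer_product_def scalar_prod_def sum_distrib_left sum_distrib_right ac_simps
       intro!: sum.cong)

lemma digit_less_power:
  fixes b q :: nat
  assumes "b < q ^ k" and "i < q"
  shows "q * b + i < q ^ Suc k"
proof -
  have "q * b + i < q * Suc b" using assms(2) by simp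
  also have "\<dots> \<le> q * q ^ k" using assms(1) by (intro mult_le_mono2) simp
  finally show ?thesis by simp
qed

theorem mainTheorem1:
  fixes q d r :: nat
    and f :: "nat \<Rightarrow> 'a::field"
    and u v :: "'a vec"
    and M :: "nat \<Rightarrow> 'a mat"
  assumes "q \<ge> 2"
    and "q_regular q f"
    and "minimal_linear_representation q d u M v f"
    and "zero_insensitive M v"
  shows "quasimultiplicative q r f \<longleftrightarrow> M 0 ^\<^sub>m r = outer_product v u"
proof -
  have rep: "linear_representation q d u M v f"
    and min: "\<And>e u' M' v'. linear_representation q e u' M' v' f \<Longrightarrow> d \<le> e"
    using assms(3) by (auto simp: minimal_linear_representation_def)
  then obtain F where F: "\<And>n. F n \<in> carrier_vec d" and F0: "F 0 = v"
    and step: "\<And>n i. i < q \<Longrightarrow> q * n + i > 0 \<Longrightarrow> F (q * n + i) = M i *\<^sub>v F n"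
    and f: "\<And>n. f n = u \<bullet> F n"
    and u: "u \<in> carrier_vec d" and v: "v \<in> carrier_vec d"
    and M: "\<And>i. i < q \<Longrightarrow> M i \<in> carrier_mat d d"
    unfolding linear_representation_def by blast
  \<comment> \<open>The one case excluded from the recursion, \<open>n = i = 0\<close>, is exactly
    \<open>M 0 *\<^sub>v v = v\<close>.\<close>
  have F_step: "F (q * n + i) = M i *\<^sub>v F n" if "i < q" for n i
    using step[OF that, of n] F0 assms(1,4) by (cases "q * n + i = 0") (auto simp: zero_insensitive_def)
  interpret zero_insensitive_minimal_representation q d u M F f
    by unfold_locales (use u M F F_step f min in auto)
  have M0: "M 0 \<in> carrier_mat d d" using M assms(1) by simp
  have pow: "M 0 ^\<^sub>m k \<in> carrier_mat d d" for k using M0 by auto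
  \<comment> \<open>Multiplication by \<open>q ^ k\<close> appends \<open>k\<close> zero digits;
    zero-insensitivity covers \<open>a = 0\<close>.\<close>
  have F_pow: "F (q ^ k * a) = M 0 ^\<^sub>m k *\<^sub>v F a" for k a
  proof (induction k arbitrary: a)
    case 0
    then show ?case using M0 F by simp
  next
    case (Suc k)
    have "F (q ^ Suc k * a) = M 0 ^\<^sub>m k *\<^sub>v F (q * a + 0)"
      using Suc[of "q * a"] by (simp add: ac_simps)
    also have "\<dots> = M 0 ^\<^sub>m Suc k *\<^sub>v F a"
      using F_step[of 0 a] assms(1) M0 pow F by (simp add: assoc_mult_mat_vec[OF pow M0 F])
    finally show ?case .
  qed
  show ?thesis
  proof
    assume "M 0 ^\<^sub>m r = outer_product v u"
    then have F_r: "F (q ^ r * a) = f a \<cdot>\<^sub>v v" for a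
      using F_pow outer_product_mult_vec[OF u F] f by simp
    \<comment> \<open>The claim is lifted from \<open>f\<close> to \<open>F\<close> so that the last
      digit of \<open>b\<close> can be split off: its matrix acts on the left, outside the scalar
      \<open>f a\<close>. For \<open>k = 0\<close> only \<open>b = 0\<close> remains.\<close>
    have "F (q ^ (k + r) * a + b) = f a \<cdot>\<^sub>v F b" if "b < q ^ k" for a b k
      using that
    proof (induction k arbitrary: b)
      case 0
      then show ?case using F_r F0 by simp
    next
      case (Suc k)
      have i: "b mod q < q" using assms(1) by simp
      have "b div q < q ^ k" using Suc.prems by (simp add: less_mult_imp_div_less mult.commute)
      then have IH: "F (q ^ (k + r) * a + b div q) = f a \<cdot>\<^sub>v F (b div q)" by (rule Suc.IH)
      have "F (q ^ (Suc k + r) * a + b) = F (q * (q ^ (k + r) * a + b div q) + b mod q)"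
        by (simp add: algebra_simps)
      also have "\<dots> = f a \<cdot>\<^sub>v (M (b mod q) *\<^sub>v F (b div q))"
        using F_step[OF i] IH mult_mat_vec[OF M[OF i] F] by simp
      also have "M (b mod q) *\<^sub>v F (b div q) = F b"
        using F_step[OF i, of "b div q"] by simp
      finally show ?case .
    qed
    then show "quasimultiplicative q r f"
      using u F by (simp add: quasimultiplicative_def f[of "_ + _"] f[symmetric])
  next
    assume qm: "quasimultiplicative q r f"
    define N where "N = {F (q ^ (k + r) * a + b) - f a \<cdot>\<^sub>v F b | a b k. b < q ^ k}"
    have Nc: "N \<subseteq> carrier_vec d" using F by (auto simp: N_def)
    \<comment> \<open>Applying \<open>M i\<close> appends the digit \<open>i\<close> to both
      arguments of \<open>F\<close>, replacing \<open>b\<close> by \<open>q * b + i\<close> and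
      \<open>k\<close> by \<open>Suc k\<close> while keeping \<open>a\<close>.\<close>
    have N_invariant: "M i *\<^sub>v y \<in> N" if i: "i < q" and "y \<in> N" for i y
    proof -
      obtain a b k where y: "y = F (q ^ (k + r) * a + b) - f a \<cdot>\<^sub>v F b" and b: "b < q ^ k"
        using \<open>y \<in> N\<close> by (auto simp: N_def)
      have "M i *\<^sub>v y = M i *\<^sub>v F (q ^ (k + r) * a + b) - f a \<cdot>\<^sub>v (M i *\<^sub>v F b)"
        using F by (simp add: y mult_minus_distrib_mat_vec[OF M[OF i]] mult_mat_vec[OF M[OF i]])
      also have "\<dots> = F (q ^ (Suc k + r) * a + (q * b + i)) - f a \<cdot>\<^sub>v F (q * b + i)"
        unfolding F_step[OF i, symmetric] by (simp add: algebra_simps)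
      finally show ?thesis using digit_less_power[OF b i] unfolding N_def by blast
    qed
    have N_orth: "u \<bullet> y = 0" if "y \<in> N" for y
      using that qm u F
      by (auto simp: N_def quasimultiplicative_def scalar_prod_minus_distrib[of _ d] f[symmetric])
    have N_zero: "F (q ^ r * a) - f a \<cdot>\<^sub>v v = 0\<^sub>v d" for a
    proof -
      have "F (q ^ (0 + r) * a + 0) - f a \<cdot>\<^sub>v F 0 \<in> N"
        unfolding N_def by (intro CollectI exI[of _ a] exI[of _ "0::nat"]) simp
      then show ?thesis
        using invariant_set_orthogonal_to_functional_imp_zero[OF Nc N_invariant N_orth] F0 by simp
    qed
    define X where "X = M 0 ^\<^sub>m r - outer_product v u"
    have oc: "outer_product v u \<in> carrier_mat d d" using u v by (simp add: outer_product_def)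
    have X: "X \<in> carrier_mat d d" unfolding X_def by (rule minus_carrier_mat[OF oc])
    have XF: "X *\<^sub>v F a = 0\<^sub>v d" for a
      using N_zero[of a] F_pow[of r a] f[of a]
      by (simp add: X_def minus_mult_distrib_mat_vec[OF pow oc F] outer_product_mult_vec[OF u F])
    \<comment> \<open>\<open>X\<close> is only known to kill the vectors \<open>F a\<close>. Working
      row by row replaces an explicit proof that they span the space.\<close>
    have "row X i = 0\<^sub>v d" if i: "i < d" for i
    proof (rule orthogonal_to_range_imp_zero)
      show "row X i \<in> carrier_vec d" using X by auto
      show "row X i \<bullet> F n = 0" for n
        using XF[of n] X i by (metis carrier_matD(1) index_mult_mat_vec index_zero_vec(1))
    qed
    then have X0: "X $$ (i, j) = 0" if "i < d" "j < d" for i j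
      using that X by (metis carrier_matD index_row(1) index_zero_vec(1))
    show "M 0 ^\<^sub>m r = outer_product v u"
    proof (rule eq_matI)
      fix i j assume "i < dim_row (outer_product v u)" "j < dim_col (outer_product v u)"
      then show "(M 0 ^\<^sub>m r) $$ (i, j) = outer_product v u $$ (i, j)"
        using X0[of i j] oc by (simp add: X_def)
    qed (use M0 oc in auto)
  qed
qed

end
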